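(* Let $X\in\mathrm{Sym}^+(p)$, let $(U,D)\in\mathcal{E}_X$, and let $k_1,\dots,k_r$ be the parts of the partition $[\mathsf{J}_D]$ of $p$ (i.e. the multiplicities of the distinct diagonal entries of $D$). Then $\mathcal{E}_X$ is diffeomorphic to a disjoint union of $$2^{r-1}\frac{p!}{k_1!\,k_2!\cdots k_r!}$$ copies of $SO(k_1)\times SO(k_2)\times\dots\times SO(k_r)$.
   Context: Let $p\ge2$. $\mathrm{Sym}^+(p)$ is the set of $p\times p$ real symmetric positive-definite matrices, $\mathrm{Diag}^+(p)$ the set of $p\times p$ diagonal matrices with positive diagonal entries, $M(p)=SO(p)\times \mathrm{Diag}^+(p)$ (a smooth manifold), $F:M(p)\to\mathrm{Sym}^+(p)$ is $F(U,D)=UDU^T$, and $\mathcal{E}_X=F^{-1}(X)\subset M(p)$. For $D=\mathrm{diag}(d_1,\dots,d_p)$, $\mathsf{J}_D$ is the partition of the set $\{1,\dots,p\}$ determined by the equivalence relation $i\sim j\iff d_i=d_j$, and $[\mathsf{J}_D]$ is the partition of the integer $p$ whose parts are the cardinalities of the blocks of $\mathsf{J}_D$. *)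

theory Defs
  imports
    "HOL-Analysis.Analysis"
    "HOL-Library.Multiset"
    "Jordan_Normal_Form.Determinant"
begin

(* HOL-Analysis matrices "real^'p^'p" are used for the fixed size p = CARD('p);
   the matrices "real mat" of Jordan_Normal_Form are used where the size k
   is a natural number that depends on D. *)

no_notation Matrix.vec_index (infixl "$" 100)
no_notation Matrix.scalar_prod (infix "\<bullet>" 70)


(* C^n on an open set U: all iterated directional derivatives up to order n
   exist (as Frechet derivatives) and are continuous. On a euclidean space
   this is the usual notion. *)
primrec Ck_on :: "nat \<Rightarrow> 'a::euclidean_space set \<Rightarrow> ('a \<Rightarrow> 'b::euclidean_space) \<Rightarrow> bool" where
  "Ck_on 0 U f \<longleftrightarrow> continuous_on U f"
| "Ck_on (Suc n) U f \<longleftrightarrow>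
     (\<forall>x\<in>U. f differentiable (at x)) \<and>
     (\<forall>v. Ck_on n U (\<lambda>x. frechet_derivative f (at x) v))"

(* A map on an arbitrary subset S of a euclidean space is smooth if near each
   point of S it is the restriction of a C^infinity map on an open set. For an
   embedded submanifold S this is smoothness for the submanifold structure. *)
definition smooth_on :: "'a::euclidean_space set \<Rightarrow> ('a \<Rightarrow> 'b::euclidean_space) \<Rightarrow> bool" where
  "smooth_on S f \<longleftrightarrow>
     (\<forall>x\<in>S. \<exists>V g. open V \<and> x \<in> V \<and> (\<forall>n. Ck_on n V g) \<and> (\<forall>y\<in>S \<inter> V. g y = f y))"

definition diffeomorphism ::
  "'a::euclidean_space set \<Rightarrow> 'b::euclidean_space set \<Rightarrow> ('a \<Rightarrow> 'b) \<Rightarrow> ('b \<Rightarrow> 'a) \<Rightarrow> bool" where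
  "diffeomorphism S T f g \<longleftrightarrow>
     smooth_on S f \<and> f ` S = T \<and> (\<forall>x\<in>S. g (f x) = x) \<and>
     smooth_on T g \<and> g ` T = S \<and> (\<forall>y\<in>T. f (g y) = y)"

definition diffeomorphic :: "'a::euclidean_space set \<Rightarrow> 'b::euclidean_space set \<Rightarrow> bool" where
  "diffeomorphic S T \<longleftrightarrow> (\<exists>f g. diffeomorphism S T f g)"

definition disjoint_copies :: "nat \<Rightarrow> 'a set \<Rightarrow> (real \<times> 'a) set" where
  "disjoint_copies N Q = real ` {..<N} \<times> Q"


definition Sym_pos :: "(real^'p^'p) set" where
  "Sym_pos = {X. Finite_Cartesian_Product.transpose X = X \<and> (\<forall>v. v \<noteq> 0 \<longrightarrow> v \<bullet> (X *v v) > 0)}"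

definition Diag_pos :: "(real^'p^'p) set" where
  "Diag_pos = {D. (\<forall>i j. i \<noteq> j \<longrightarrow> D $ i $ j = 0) \<and> (\<forall>i. D $ i $ i > 0)}"

definition M_space :: "((real^'p^'p) \<times> (real^'p^'p)) set" where
  "M_space = {U. rotation_matrix U} \<times> Diag_pos"

definition eigen_map :: "(real^'p^'p) \<times> (real^'p^'p) \<Rightarrow> real^'p^'p" where
  "eigen_map = (\<lambda>(U, D). U ** D ** Finite_Cartesian_Product.transpose U)"

definition eigen_fiber :: "real^'p^'p \<Rightarrow> ((real^'p^'p) \<times> (real^'p^'p)) set" where
  "eigen_fiber X = {m \<in> M_space. eigen_map m = X}"

definition diag_partition :: "real^'p^'p \<Rightarrow> 'p set set" where
  "diag_partition D = UNIV // {(i, j). D $ i $ i = D $ j $ j}"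

(* The integer partition given by a set partition, as the multiset of its parts. *)
definition partition_type :: "'p set set \<Rightarrow> nat multiset" where
  "partition_type J = image_mset card (mset_set J)"


definition SO :: "nat \<Rightarrow> real mat set" where
  "SO k = {A \<in> carrier_mat k k. transpose_mat A * A = 1\<^sub>m k \<and> Determinant.det A = 1}"

definition SO_product :: "nat list \<Rightarrow> real mat list set" where
  "SO_product ks = {As. length As = length ks \<and> (\<forall>m<length ks. As ! m \<in> SO (ks ! m))}"

(* Lists of at most p matrices of size at most p, zero-padded to a p * p * p
   array. For fixed sizes this is the restriction of a linear embedding of the product
   of the matrix spaces, so the image of SO(k_1) x ... x SO(k_r) carries
   the smooth structure of that product. The bijection to_nat_on UNIV from 'p
   to {0..<p} serves only to number the coordinates. *)
definition pad_matrices :: "real mat list \<Rightarrow> real^'p::finite^'p^'p" where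
  "pad_matrices As = (\<chi> m i j.
     let m' = to_nat_on (UNIV :: 'p set) m;
         i' = to_nat_on (UNIV :: 'p set) i;
         j' = to_nat_on (UNIV :: 'p set) j
     in if m' < length As \<and> i' < dim_row (As ! m') \<and> j' < dim_col (As ! m')
        then (As ! m') $$ (i', j') else 0)"

lemma pad_matrices_inj_on:
  assumes "length ks \<le> CARD('p::finite)" and "\<forall>k\<in>set ks. k \<le> CARD('p)"
  shows "inj_on (pad_matrices :: real mat list \<Rightarrow> real^'p^'p^'p) (SO_product ks)"
proof (rule inj_onI)
  fix As Bs :: "real mat list"
  assume A: "As \<in> SO_product ks" and B: "Bs \<in> SO_product ks"
    and eq: "(pad_matrices As :: real^'p^'p^'p) = pad_matrices Bs"
  have surj: "\<exists>x::'p. to_nat_on UNIV x = n" if "n < CARD('p)" for n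
  proof -
    have "n \<in> to_nat_on UNIV ` (UNIV :: 'p set)"
      using to_nat_on_finite[of "UNIV :: 'p set"] that by (simp add: bij_betw_def)
    then show ?thesis by auto
  qed
  have len: "length As = length ks" "length Bs = length ks"
    using A B by (auto simp: SO_product_def)
  show "As = Bs"
  proof (rule nth_equalityI)
    fix n assume "n < length As"
    then have n: "n < length ks" using len by simp
    have dA: "As ! n \<in> carrier_mat (ks ! n) (ks ! n)" and dB: "Bs ! n \<in> carrier_mat (ks ! n) (ks ! n)"
      using A B n by (auto simp: SO_product_def SO_def)
    have k: "ks ! n \<le> CARD('p)" using assms(2) n by simp
    show "As ! n = Bs ! n"
    proof (rule eq_matI)
      fix a b assume "a < dim_row (Bs ! n)" "b < dim_col (Bs ! n)"
      then have ab: "a < ks ! n" "b < ks ! n" using dB by auto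
      obtain x y z :: 'p where xyz: "to_nat_on UNIV x = n" "to_nat_on UNIV y = a" "to_nat_on UNIV z = b"
        using surj[of n] surj[of a] surj[of b] n ab k assms(1) by auto
      have "(pad_matrices As :: real^'p^'p^'p) $ x $ y $ z = pad_matrices Bs $ x $ y $ z"
        using eq by simp
      then show "(As ! n) $$ (a, b) = (Bs ! n) $$ (a, b)"
        using xyz n ab dA dB len by (simp add: pad_matrices_def Let_def)
    qed (use dA dB in auto)
  qed (use len in simp)
qed

end

theory Submission
  imports Defs "HOL-Combinatorics.Multiset_Permutations"
begin

text \<open>
  Let \<open>d\<close> be the diagonal of \<open>D\<close>. If \<open>(V, diag l)\<close> lies in the fibre of
  \<open>X = U D U\<^sup>T\<close>, then the orthogonal matrix \<open>R = U\<^sup>T V\<close> satisfies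
  \<open>R\<^sub>i\<^sub>j l\<^sub>j = d\<^sub>i R\<^sub>i\<^sub>j\<close>. The squares of the entries of \<open>R\<close> form a doubly stochastic
  matrix supported where \<open>l\<^sub>j = d\<^sub>i\<close>, so \<open>l\<close> and \<open>d\<close> take every value equally
  often (\<open>orthogonal_similar_diagonal_multiplicities\<close>). Conversely, each of the
  \<open>p! / (k\<^sub>1! \<dots> k\<^sub>r!)\<close> rearrangements \<open>l\<close> of \<open>d\<close> occurs: permuting the columns of
  \<open>U\<close>, and negating one column if the determinant requires it, gives a rotation \<open>W\<^sub>l\<close> with
  \<open>W\<^sub>l (diag l) W\<^sub>l\<^sup>T = X\<close> (\<open>rotation_diagonalizes_permuted\<close>).

  For a fixed \<open>l\<close> the rotations \<open>V\<close> with \<open>V (diag l) V\<^sup>T = X\<close> form the coset of \<open>W\<^sub>l\<close> by the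
  rotations that commute with \<open>diag l\<close>. These are block-diagonal with respect to the
  level sets of \<open>l\<close>, with orthogonal blocks whose determinants multiply to 1. The set
  \<open>P\<close> of blocks of determinant \<open>-1\<close> therefore has an even number of elements, which
  leaves \<open>2\<^bsup>r - 1\<^esup>\<close> possibilities. Negating one coordinate in each block of \<open>P\<close>, by a
  matrix \<open>E\<^sub>P\<close>, turns all the blocks into special orthogonal ones. So the fibre is the
  disjoint union of the sets \<open>W\<^sub>l E\<^sub>P H\<^sub>l \<times> {diag l}\<close>
  (\<open>eigen_fiber_eq_Union_fiber_pieces\<close>, \<open>disjoint_fiber_pieces\<close>), where \<open>H\<^sub>l\<close> is the
  group of block-diagonal matrices with blocks in \<open>SO(k\<^sub>m)\<close>.

  Reading off the blocks and reassembling them are mutually inverse linear maps, so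
  each of these sets is diffeomorphic to \<open>SO(k\<^sub>1) \<times> \<dots> \<times> SO(k\<^sub>r)\<close> by restrictions of
  affine maps (\<open>diffeomorphic_block_coset\<close>). There are finitely many of them and they
  are closed, so they have disjoint neighbourhoods in the fibre and the
  diffeomorphisms can be glued (\<open>diffeomorphic_disjoint_copies\<close>).
\<close>

section \<open>Smooth maps between subsets of euclidean spaces\<close>

text \<open>A derivative at a point of an open set depends only on the values on that set,
whereas \<open>frechet_derivative\<close> is applied to the whole function. This lets formulas for
derivatives that hold only on \<open>V\<close> be used inside \<open>Ck_on\<close>.\<close>

lemma Ck_on_cong:
  assumes "open V" "\<And>x. x \<in> V \<Longrightarrow> f x = g x" "Ck_on n V f"
  shows "Ck_on n V g"
  using assms(2,3)
proof (induction n arbitrary: f g)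
  case 0
  then show ?case by (auto cong: continuous_on_cong)
next
  case (Suc n)
  have der: "(g has_derivative frechet_derivative f (at x)) (at x)" if "x \<in> V" for x
  proof (rule has_derivative_transform_within_open)
    show "(f has_derivative frechet_derivative f (at x)) (at x)"
      using Suc.prems(2) that by (simp add: frechet_derivative_works)
  qed (use assms(1) that Suc.prems(1) in auto)
  have eq: "frechet_derivative f (at x) v = frechet_derivative g (at x) v" if "x \<in> V" for x v
    using frechet_derivative_at[OF der[OF that]] by simp
  have "Ck_on n V (\<lambda>x. frechet_derivative g (at x) v)" for v
    by (rule Suc.IH[of "\<lambda>x. frechet_derivative f (at x) v"]) (use eq Suc.prems(2) in auto)
  then show ?case
    using der by (auto simp: differentiable_def)
qed

lemma Ck_on_subset: "Ck_on n V f \<Longrightarrow> W \<subseteq> V \<Longrightarrow> Ck_on n W f"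
  by (induction n arbitrary: f) (auto intro: continuous_on_subset)

lemma Ck_on_const: "Ck_on n V (\<lambda>x. c)"
  by (induction n arbitrary: c) (auto simp: frechet_derivative_const)

lemma Ck_on_affine:
  assumes "bounded_linear L"
  shows "Ck_on n V (\<lambda>x. c + L x)"
proof -
  have der: "((\<lambda>x. c + L x) has_derivative L) (at x)" for x
    using has_derivative_add[OF has_derivative_const bounded_linear_imp_has_derivative[OF assms]]
    by simp
  have fd: "frechet_derivative (\<lambda>x. c + L x) (at x) = L" for x
    using frechet_derivative_at[OF der] by simp
  show ?thesis
  proof (cases n)
    case 0
    then show ?thesis
      by (auto intro!: continuous_intros linear_continuous_on[OF assms])
  next
    case (Suc m)
    then show ?thesis
      using der by (auto simp: fd Ck_on_const differentiable_def)
  qed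
qed

lemma Ck_on_affine_compose:
  assumes "bounded_linear L" "open V" "Ck_on n V f"
  shows "Ck_on n V (\<lambda>x. c + L (f x))"
  using assms(3)
proof (induction n arbitrary: c f)
  case 0
  then show ?case
    by (auto intro!: continuous_intros bounded_linear.continuous_on[OF assms(1)])
next
  case (Suc n)
  have der: "((\<lambda>x. c + L (f x)) has_derivative (\<lambda>v. L (frechet_derivative f (at x) v))) (at x)"
    if "x \<in> V" for x
  proof -
    have "(f has_derivative frechet_derivative f (at x)) (at x)"
      using Suc.prems that by (simp add: frechet_derivative_works)
    from has_derivative_add[OF has_derivative_const bounded_linear.has_derivative[OF assms(1) this]]
    show ?thesis by simp
  qed
  have "Ck_on n V (\<lambda>x. frechet_derivative (\<lambda>x. c + L (f x)) (at x) v)" for v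
  proof (rule Ck_on_cong[OF assms(2)])
    show "Ck_on n V (\<lambda>x. 0 + L (frechet_derivative f (at x) v))"
      using Suc.IH[of _ 0] Suc.prems by simp
    show "0 + L (frechet_derivative f (at x) v) = frechet_derivative (\<lambda>x. c + L (f x)) (at x) v"
      if "x \<in> V" for x
      by (simp flip: frechet_derivative_at[OF der[OF that]])
  qed
  then show ?case using der by (auto simp: differentiable_def)
qed

lemma Ck_on_compose_linear:
  assumes "bounded_linear L" "open V" "Ck_on n V f"
  shows "Ck_on n (L -` V) (\<lambda>x. f (L x))"
  using assms(3)
proof (induction n arbitrary: f)
  case 0
  have "continuous_on (L -` V) L"
    using assms(1) by (rule linear_continuous_on)
  then show ?case
    using 0 by (auto intro: continuous_on_compose2[of V f])
next
  case (Suc n)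
  have opn: "open (L -` V)"
    using assms(1,2) by (intro open_vimage linear_continuous_on)
  have der: "((\<lambda>x. f (L x)) has_derivative (\<lambda>v. frechet_derivative f (at (L x)) (L v))) (at x)"
    if "L x \<in> V" for x
  proof -
    have "(f has_derivative frechet_derivative f (at (L x))) (at (L x))"
      using Suc.prems that by (simp add: frechet_derivative_works)
    from has_derivative_compose[OF bounded_linear_imp_has_derivative[OF assms(1)] this]
    show ?thesis .
  qed
  have "Ck_on n (L -` V) (\<lambda>x. frechet_derivative (\<lambda>x. f (L x)) (at x) v)" for v
  proof (rule Ck_on_cong[OF opn])
    show "Ck_on n (L -` V) (\<lambda>x. frechet_derivative f (at (L x)) (L v))"
      using Suc.IH[of "\<lambda>y. frechet_derivative f (at y) (L v)"] Suc.prems by auto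
    show "frechet_derivative f (at (L x)) (L v) = frechet_derivative (\<lambda>x. f (L x)) (at x) v"
      if "x \<in> L -` V" for x
      using that by (simp flip: frechet_derivative_at[OF der])
  qed
  then show ?case using der by (fastforce simp: differentiable_def)
qed

lemma smooth_on_affine: "bounded_linear L \<Longrightarrow> smooth_on S (\<lambda>x. c + L x)"
  unfolding smooth_on_def
  by (intro ballI exI[of _ UNIV] exI[of _ "\<lambda>x. c + L x"]) (auto intro: Ck_on_affine)

section \<open>Finite unions of separated pieces\<close>

lemma closed_separation:
  assumes "finite T" "\<And>t. t \<in> T \<Longrightarrow> closed (S t)" "disjoint_family_on S T" "t \<in> T" "x \<in> S t"
  obtains W where "open W" "x \<in> W" "(\<Union>s\<in>T. S s) \<inter> W \<subseteq> S t"
proof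
  show "open (- (\<Union>s\<in>T - {t}. S s))"
    using assms(1,2) by (intro open_Compl closed_UN) auto
  show "x \<in> - (\<Union>s\<in>T - {t}. S s)"
    using assms(3-5) by (auto simp: disjoint_family_on_def)
qed auto

text \<open>Smoothness is local, and near a point of one piece the union coincides with
that piece. So diffeomorphisms chosen separately on the pieces combine to one
diffeomorphism, in which the number of the piece becomes the real coordinate that
labels the copy.\<close>

lemma diffeomorphic_disjoint_copies:
  fixes S :: "'i \<Rightarrow> 'a::euclidean_space set" and Q :: "'b::euclidean_space set"
  assumes fin: "finite T" and cl: "\<And>t. t \<in> T \<Longrightarrow> closed (S t)" and dj: "disjoint_family_on S T"
    and diff: "\<And>t. t \<in> T \<Longrightarrow> diffeomorphic (S t) Q"
  shows "diffeomorphic (\<Union>t\<in>T. S t) (disjoint_copies (card T) Q)"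
proof -
  obtain num where num: "bij_betw num T {..<card T}"
    using ex_bij_betw_finite_nat[OF fin] by (auto simp: atLeast0LessThan)
  define tag where "tag n = inv_into T num n" for n
  have tag_num [simp]: "tag (num t) = t" if "t \<in> T" for t
    using num that by (simp add: tag_def bij_betw_def)
  have num_lt: "num t < card T" if "t \<in> T" for t
    using num that by (auto simp: bij_betw_def)
  have tag_in: "tag n \<in> T" and num_tag [simp]: "num (tag n) = n" if "n < card T" for n
    using num that by (auto simp: tag_def bij_betw_def inv_into_into f_inv_into_f)
  obtain f g where fg: "\<And>t. t \<in> T \<Longrightarrow> diffeomorphism (S t) Q (f t) (g t)"
    using diff unfolding diffeomorphic_def by metis
  define piece where "piece x = (THE t. t \<in> T \<and> x \<in> S t)" for x
  have piece: "piece x = t" if "t \<in> T" "x \<in> S t" for t x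
    unfolding piece_def using dj that
    by (intro the_equality) (auto simp: disjoint_family_on_def)
  define F where "F x = (real (num (piece x)), f (piece x) x)" for x
  \<comment> \<open>On the target the first coordinate is a natural number, which the floor recovers.\<close>
  define G :: "real \<times> 'b \<Rightarrow> 'a" where "G = (\<lambda>(s, y). g (tag (nat \<lfloor>s\<rfloor>)) y)"
  have F: "F x = (real (num t), f t x)" if "t \<in> T" "x \<in> S t" for t x
    using piece[OF that] by (simp add: F_def)
  have G: "G (real n, y) = g (tag n) y" for n y
    by (simp add: G_def)
  have fQ: "f t x \<in> Q" and gf: "g t (f t x) = x" if "t \<in> T" "x \<in> S t" for t x
    using fg[OF that(1)] that(2) by (auto simp: diffeomorphism_def)
  have gS: "g t y \<in> S t" and fgy: "f t (g t y) = y" if "t \<in> T" "y \<in> Q" for t y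
    using fg[OF that(1)] that(2) by (auto simp: diffeomorphism_def)
  have FG: "F (G z) = z" and GT: "G z \<in> (\<Union>t\<in>T. S t)" if zQ: "z \<in> disjoint_copies (card T) Q" for z
  proof -
    obtain n y where z: "z = (real n, y)" "n < card T" "y \<in> Q"
      using zQ by (auto simp: disjoint_copies_def)
    have "g (tag n) y \<in> S (tag n)"
      using gS tag_in z by auto
    then show "F (G z) = z" "G z \<in> (\<Union>t\<in>T. S t)"
      using z tag_in F[of "tag n" "g (tag n) y"] by (auto simp: G fgy)
  qed
  have GF: "G (F x) = x" and FQ: "F x \<in> disjoint_copies (card T) Q" if "x \<in> (\<Union>t\<in>T. S t)" for x
    using that num_lt by (auto simp: F G gf fQ disjoint_copies_def)
  have smF: "smooth_on (\<Union>t\<in>T. S t) F"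
    unfolding smooth_on_def
  proof
    fix x assume "x \<in> (\<Union>t\<in>T. S t)"
    then obtain t where t: "t \<in> T" "x \<in> S t" by auto
    obtain W where W: "open W" "x \<in> W" "(\<Union>s\<in>T. S s) \<inter> W \<subseteq> S t"
      using closed_separation[OF fin cl dj t] by blast
    obtain V h where V: "open V" "x \<in> V" "\<And>n. Ck_on n V h" "\<And>y. y \<in> S t \<inter> V \<Longrightarrow> h y = f t y"
      using fg[OF t(1)] t(2) by (fastforce simp: diffeomorphism_def smooth_on_def)
    have "Ck_on n (V \<inter> W) (\<lambda>y. (real (num t), 0) + (0, h y))" for n
      by (rule Ck_on_affine_compose)
         (use V W Ck_on_subset[of n V h] in \<open>auto intro!: bounded_linear_intros\<close>)
    then show "\<exists>V g. open V \<and> x \<in> V \<and> (\<forall>n. Ck_on n V g) \<and> (\<forall>y\<in>(\<Union>t\<in>T. S t) \<inter> V. g y = F y)"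
      by (intro exI[of _ "V \<inter> W"] exI[of _ "\<lambda>y. (real (num t), 0) + (0, h y)"])
         (use V W t in \<open>auto simp: F subset_iff\<close>)
  qed
  have smG: "smooth_on (disjoint_copies (card T) Q) G"
    unfolding smooth_on_def
  proof
    fix z assume "z \<in> disjoint_copies (card T) Q"
    then obtain n q where z: "z = (real n, q)" "n < card T" "q \<in> Q"
      by (auto simp: disjoint_copies_def)
    obtain V h where V: "open V" "q \<in> V" "\<And>m. Ck_on m V h" "\<And>y. y \<in> Q \<inter> V \<Longrightarrow> h y = g (tag n) y"
      using fg[OF tag_in[OF z(2)]] z(3) by (fastforce simp: diffeomorphism_def smooth_on_def)
    \<comment> \<open>Distinct copies are at distance at least 1.\<close>
    define W where "W = {real n - 1 <..< real n + 1} \<times> V"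
    have "Ck_on m W (\<lambda>p. h (snd p))" for m
      by (rule Ck_on_subset[OF Ck_on_compose_linear[OF bounded_linear_snd V(1) V(3)[of m]]])
         (auto simp: W_def)
    moreover have "h (snd p) = G p" if pW: "p \<in> disjoint_copies (card T) Q \<inter> W" for p
    proof -
      obtain k y where p: "p = (real k, y)" "y \<in> Q"
        using pW by (auto simp: disjoint_copies_def)
      have "real n - 1 < real k" "real k < real n + 1" "y \<in> V"
        using pW p by (auto simp: W_def)
      then have "k = n" by linarith
      then show ?thesis using p V(4) \<open>y \<in> V\<close> by (simp add: G)
    qed
    ultimately show "\<exists>V g. open V \<and> z \<in> V \<and> (\<forall>n. Ck_on n V g) \<and>
        (\<forall>y\<in>disjoint_copies (card T) Q \<inter> V. g y = G y)"
      by (intro exI[of _ W] exI[of _ "\<lambda>p. h (snd p)"])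
         (use V z in \<open>auto simp: W_def open_Times\<close>)
  qed
  have "F ` (\<Union>t\<in>T. S t) = disjoint_copies (card T) Q"
  proof (intro equalityI subsetI)
    fix z assume "z \<in> disjoint_copies (card T) Q"
    then show "z \<in> F ` (\<Union>t\<in>T. S t)"
      using FG GT by (intro image_eqI[where x = "G z"]) auto
  qed (use FQ in blast)
  moreover have "G ` disjoint_copies (card T) Q = (\<Union>t\<in>T. S t)"
  proof (intro equalityI subsetI)
    fix x assume "x \<in> (\<Union>t\<in>T. S t)"
    then show "x \<in> G ` disjoint_copies (card T) Q"
      using GF FQ by (intro image_eqI[where x = "F x"]) auto
  qed (use GT in blast)
  ultimately have "diffeomorphism (\<Union>t\<in>T. S t) (disjoint_copies (card T) Q) F G"
    unfolding diffeomorphism_def using smF smG GF FG by blast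
  then show ?thesis unfolding diffeomorphic_def by blast
qed

section \<open>Determinants of principal submatrices\<close>

no_notation transpose_mat (\<open>(_\<^sup>T)\<close> [1000])
notation Finite_Cartesian_Product.transpose ("(_\<^sup>T)" [1000] 999)

text \<open>Filling up the principal submatrix on \<open>S\<close> with the identity keeps all the matrices
in one type, so that determinants of blocks of different sizes can be multiplied.\<close>

definition restrict_matrix :: "'p set \<Rightarrow> real^'p^'p \<Rightarrow> real^'p^'p" where
  "restrict_matrix S A = (\<chi> x y. if x \<in> S \<and> y \<in> S then A $ x $ y else of_bool (x = y))"

lemma restrict_matrix_nth [simp]:
  "restrict_matrix S A $ x $ y = (if x \<in> S \<and> y \<in> S then A $ x $ y else of_bool (x = y))"
  by (simp add: restrict_matrix_def)

lemma restrict_matrix_UNIV [simp]: "restrict_matrix UNIV A = A"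
  by (simp add: Finite_Cartesian_Product.vec_eq_iff)

lemma restrict_matrix_empty [simp]: "restrict_matrix {} A = Finite_Cartesian_Product.mat 1"
  by (simp add: Finite_Cartesian_Product.vec_eq_iff Finite_Cartesian_Product.mat_def)

lemma restrict_matrix_one [simp]:
  "restrict_matrix S (Finite_Cartesian_Product.mat 1) = Finite_Cartesian_Product.mat 1"
  by (simp add: Finite_Cartesian_Product.vec_eq_iff Finite_Cartesian_Product.mat_def)

lemma transpose_restrict_matrix: "(restrict_matrix S A)\<^sup>T = restrict_matrix S (A\<^sup>T)"
  by (auto simp: Finite_Cartesian_Product.vec_eq_iff Finite_Cartesian_Product.transpose_def)

lemma restrict_matrix_mult:
  fixes A B :: "real^'p^'p"
  assumes "\<And>x y. x \<in> S \<Longrightarrow> y \<notin> S \<Longrightarrow> A $ x $ y = 0"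
  shows "restrict_matrix S (A ** B) = restrict_matrix S A ** restrict_matrix S B"
proof -
  have "restrict_matrix S (A ** B) $ x $ y = (restrict_matrix S A ** restrict_matrix S B) $ x $ y"
    for x y
  proof (cases "x \<in> S")
    case True
    have "(\<Sum>z\<in>UNIV. restrict_matrix S A $ x $ z * restrict_matrix S B $ z $ y) =
        (\<Sum>z\<in>UNIV. if y \<in> S then A $ x $ z * B $ z $ y else 0)"
      using True assms by (intro sum.cong) auto
    then show ?thesis
      using True by (auto simp: matrix_matrix_mult_def)
  next
    case False
    then show ?thesis
      by (simp add: matrix_matrix_mult_def of_bool_def if_distrib[of "\<lambda>c. c * _"] cong: if_cong)
  qed
  then show ?thesis by (simp add: Finite_Cartesian_Product.vec_eq_iff)
qed

text \<open>The factor for \<open>S\<close> acts as the identity on \<open>T\<close> and vice versa. This is the step that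
makes the determinant of a block-diagonal matrix a product.\<close>

lemma restrict_matrix_Un:
  fixes A :: "real^'p^'p"
  assumes "S \<inter> T = {}"
    and "\<And>x y. x \<in> S \<Longrightarrow> y \<in> T \<Longrightarrow> A $ x $ y = 0"
    and "\<And>x y. x \<in> T \<Longrightarrow> y \<in> S \<Longrightarrow> A $ x $ y = 0"
  shows "restrict_matrix (S \<union> T) A = restrict_matrix S A ** restrict_matrix T A"
proof -
  have "restrict_matrix (S \<union> T) A $ x $ y = (restrict_matrix S A ** restrict_matrix T A) $ x $ y"
    for x y
  proof (cases "x \<in> S")
    case True
    have "(\<Sum>z\<in>UNIV. restrict_matrix S A $ x $ z * restrict_matrix T A $ z $ y) =
        (\<Sum>z\<in>UNIV. if z = y then (if y \<in> S then A $ x $ y else 0) else 0)"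
      using True assms(1) by (intro sum.cong) auto
    then show ?thesis
      using True assms by (auto simp: matrix_matrix_mult_def)
  next
    case False
    then show ?thesis
      using assms by (auto simp: matrix_matrix_mult_def of_bool_def if_distrib[of "\<lambda>c. c * _"] cong: if_cong)
  qed
  then show ?thesis by (simp add: Finite_Cartesian_Product.vec_eq_iff)
qed

lemma continuous_on_det:
  fixes f :: "'a::topological_space \<Rightarrow> real^'p^'p"
  assumes "\<And>i j. continuous_on S (\<lambda>x. f x $ i $ j)"
  shows "continuous_on S (\<lambda>x. Determinants.det (f x))"
  unfolding Determinants.det_def by (intro continuous_intros assms)

text \<open>In the Leibniz sum for the padded matrix a permutation that moves a point outside \<open>S\<close>
meets a zero off-diagonal entry. The permutations of \<open>S\<close> that are left correspond under
the enumeration \<open>e\<close> to those of \<open>{0..<k}\<close>, with the same sign.\<close>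

lemma det_restrict_matrix:
  fixes A :: "real^'p^'p"
  assumes e: "bij_betw e {..<k} S"
  shows "Determinants.det (restrict_matrix S A) =
    Determinant.det (Matrix.mat k k (\<lambda>(i, j). A $ e i $ e j))"
proof -
  let ?R = "restrict_matrix S A"
  have e': "bij_betw e {0..<k} S"
    using e by (simp add: atLeast0LessThan)
  have inj: "inj_on e {0..<k}" and img: "e ` {0..<k} = S"
    using e' by (auto simp: bij_betw_def)
  let ?term = "\<lambda>p. of_int (sign p) * (\<Prod>i\<in>UNIV. ?R $ i $ p i)"
  have outside: "?term p = 0" if p: "p permutes UNIV" "\<not> p permutes S" for p
  proof -
    obtain x where "x \<notin> S" "p x \<noteq> x"
      using p permutes_superset[of p UNIV S] by auto
    \<comment> \<open>Row \<open>x\<close> of the padded matrix is a row of the identity.\<close>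
    then have "?R $ x $ p x = 0" by simp
    then have "(\<Prod>i\<in>UNIV. ?R $ i $ p i) = 0"
      by (intro prod_zero) (auto simp del: restrict_matrix_nth)
    then show ?thesis by simp
  qed
  have "Determinants.det ?R = (\<Sum>p | p permutes S. ?term p)"
    unfolding Determinants.det_def
    by (rule sum.mono_neutral_right)
       (use outside permutes_subset[of _ S UNIV] in \<open>auto simp: finite_permutations\<close>)
  also have "\<dots> = (\<Sum>q | q permutes {0..<k}. ?term (map_permutation {0..<k} e q))"
  proof (rule sum.reindex_bij_betw[symmetric])
    show "bij_betw (map_permutation {0..<k} e) {q. q permutes {0..<k}} {p. p permutes S}"
      by (rule bij_betw_byWitness[where f' = "map_permutation S (inv_into {0..<k} e)"])
         (use e' inj in \<open>auto intro!: map_permutation_permutes map_permutation_compose_inv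
            bij_betw_inv_into simp: bij_betw_inv_into_right\<close>)
  qed
  also have "\<dots> = (\<Sum>q | q permutes {0..<k}. of_int (sign q) *
      (\<Prod>i = 0..<k. Matrix.mat k k (\<lambda>(i, j). A $ e i $ e j) $$ (i, q i)))"
  proof (rule sum.cong[OF refl])
    fix q assume "q \<in> {q. q permutes {0..<k}}"
    then have q: "q permutes {0..<k}" by simp
    let ?p = "map_permutation {0..<k} e q"
    have p: "?p permutes S"
      using e' q by (rule map_permutation_permutes)
    have "(\<Prod>x\<in>UNIV. ?R $ x $ ?p x) = (\<Prod>x\<in>S. ?R $ x $ ?p x)"
      by (rule prod.mono_neutral_right) (use p in \<open>auto simp: permutes_not_in\<close>)
    also have "\<dots> = (\<Prod>i = 0..<k. ?R $ e i $ ?p (e i))"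
      by (rule prod.reindex_bij_betw[OF e', symmetric])
    also have "\<dots> = (\<Prod>i = 0..<k. Matrix.mat k k (\<lambda>(i, j). A $ e i $ e j) $$ (i, q i))"
    proof (rule prod.cong[OF refl])
      fix i assume i: "i \<in> {0..<k}"
      then have qi: "q i \<in> {0..<k}"
        using q by (simp add: permutes_in_image)
      have "?p (e i) = e (q i)"
        using inj i by (rule map_permutation_apply)
      moreover have "e i \<in> S" "e (q i) \<in> S"
        using i qi img by auto
      ultimately show "?R $ e i $ ?p (e i) = Matrix.mat k k (\<lambda>(i, j). A $ e i $ e j) $$ (i, q i)"
        using i qi by simp
    qed
    finally show "?term ?p = of_int (sign q) *
        (\<Prod>i = 0..<k. Matrix.mat k k (\<lambda>(i, j). A $ e i $ e j) $$ (i, q i))"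
      using sign_map_permutation[OF inj q] by simp
  qed
  also have "\<dots> = Determinant.det (Matrix.mat k k (\<lambda>(i, j). A $ e i $ e j))"
    by (subst Determinant.det_def'[of _ k]) auto
  finally show ?thesis .
qed

section \<open>Block-diagonal matrices and reflections in single blocks\<close>

text \<open>The blocks are the level sets of \<open>lab\<close>. Below, \<open>lab\<close> is the diagonal of a diagonal
matrix, and the condition then characterizes the matrices that commute with it.\<close>

definition block_diagonal :: "('p \<Rightarrow> 'l) \<Rightarrow> real^'p^'p \<Rightarrow> bool" where
  "block_diagonal lab A \<longleftrightarrow> (\<forall>x y. lab x \<noteq> lab y \<longrightarrow> A $ x $ y = 0)"

lemma block_diagonal_mult:
  fixes A B :: "real^'p^'p"
  assumes "block_diagonal lab A" "block_diagonal lab B"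
  shows "block_diagonal lab (A ** B)"
  using assms unfolding block_diagonal_def matrix_matrix_mult_def
  by (auto intro!: sum.neutral) metis

lemma block_diagonal_transpose: "block_diagonal lab A \<Longrightarrow> block_diagonal lab (A\<^sup>T)"
  by (auto simp: block_diagonal_def Finite_Cartesian_Product.transpose_def)

lemma det_block_diagonal:
  fixes A :: "real^'p^'p" and lab :: "'p \<Rightarrow> 'l"
  assumes "block_diagonal lab A"
  shows "Determinants.det A = (\<Prod>c\<in>range lab. Determinants.det (restrict_matrix (lab -` {c}) A))"
proof -
  have "Determinants.det (restrict_matrix (lab -` C) A) =
      (\<Prod>c\<in>C. Determinants.det (restrict_matrix (lab -` {c}) A))" if "finite C" for C
    using that
  proof induction
    case (insert c C)
    have "restrict_matrix (lab -` {c} \<union> lab -` C) A =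
        restrict_matrix (lab -` {c}) A ** restrict_matrix (lab -` C) A"
    proof (rule restrict_matrix_Un)
      have zero: "A $ x $ y = 0" if "lab x \<noteq> lab y" for x y
        using assms that by (simp add: block_diagonal_def)
      show "A $ x $ y = 0" if "x \<in> lab -` {c}" "y \<in> lab -` C" for x y
        using that insert.hyps by (intro zero) auto
      show "A $ x $ y = 0" if "x \<in> lab -` C" "y \<in> lab -` {c}" for x y
        using that insert.hyps by (intro zero) auto
    qed (use insert.hyps in auto)
    moreover have "lab -` insert c C = lab -` {c} \<union> lab -` C" by auto
    ultimately show ?case
      using insert by (simp add: Determinants.det_mul)
  qed simp
  from this[of "range lab"] have "Determinants.det (restrict_matrix (lab -` range lab) A) =
      (\<Prod>c\<in>range lab. Determinants.det (restrict_matrix (lab -` {c}) A))"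
    by simp
  moreover have "lab -` range lab = UNIV" by auto
  ultimately show ?thesis by simp
qed

lemma restrict_block_mult:
  fixes A B :: "real^'p^'p"
  assumes "block_diagonal lab A"
  shows "restrict_matrix (lab -` {c}) (A ** B) =
    restrict_matrix (lab -` {c}) A ** restrict_matrix (lab -` {c}) B"
  by (rule restrict_matrix_mult) (use assms in \<open>auto simp: block_diagonal_def\<close>)

lemma orthogonal_restrict_block:
  fixes A :: "real^'p^'p"
  assumes "block_diagonal lab A" "orthogonal_matrix A"
  shows "orthogonal_matrix (restrict_matrix (lab -` {c}) A)"
  using assms block_diagonal_transpose[OF assms(1)]
  by (simp add: orthogonal_matrix transpose_restrict_matrix flip: restrict_block_mult)

definition block_rep :: "('p \<Rightarrow> 'l) \<Rightarrow> 'l \<Rightarrow> 'p" where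
  "block_rep lab c = (SOME x. lab x = c)"

text \<open>One representative for each sign pattern of determinants of the blocks: for \<open>c \<in> range lab\<close>
the block with label \<open>c\<close> has determinant \<open>-1\<close> if \<open>c \<in> P\<close> and 1 otherwise.\<close>

definition block_reflection :: "('p \<Rightarrow> 'l) \<Rightarrow> 'l set \<Rightarrow> real^'p^'p" where
  "block_reflection lab P =
     (\<chi> x y. if x = y then (if lab x \<in> P \<and> x = block_rep lab (lab x) then -1 else 1) else 0)"

lemma block_rep: "lab (block_rep lab (lab x)) = lab x"
  unfolding block_rep_def by (rule someI[of _ x]) simp

lemma block_reflection_diagonal: "block_diagonal lab (block_reflection lab P)"
  by (auto simp: block_diagonal_def block_reflection_def)

lemma transpose_block_reflection: "(block_reflection lab P)\<^sup>T = block_reflection lab P"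
  by (auto simp: Finite_Cartesian_Product.vec_eq_iff Finite_Cartesian_Product.transpose_def block_reflection_def)

lemma block_reflection_square:
  "block_reflection lab P ** block_reflection lab P = Finite_Cartesian_Product.mat 1"
  by (auto simp: Finite_Cartesian_Product.vec_eq_iff matrix_matrix_mult_def block_reflection_def Finite_Cartesian_Product.mat_def
      if_distrib[of "\<lambda>c. c * _"] cong: if_cong)

lemma orthogonal_block_reflection: "orthogonal_matrix (block_reflection lab P)"
  by (simp add: orthogonal_matrix transpose_block_reflection block_reflection_square)

lemma det_restrict_block_reflection:
  assumes "c \<in> range lab"
  shows "Determinants.det (restrict_matrix (lab -` {c}) (block_reflection lab P)) =
    (if c \<in> P then -1 else 1)"
proof -
  have "Determinants.det (restrict_matrix (lab -` {c}) (block_reflection lab P)) =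
      (\<Prod>x\<in>UNIV. restrict_matrix (lab -` {c}) (block_reflection lab P) $ x $ x)"
    by (rule det_diagonal) (simp add: block_reflection_def)
  also have "\<dots> = (\<Prod>x\<in>UNIV. if x = block_rep lab c then (if c \<in> P then -1 else 1) else 1)"
    using assms block_rep[of lab] by (intro prod.cong) (auto simp: block_reflection_def)
  also have "\<dots> = (if c \<in> P then -1 else 1)"
    by simp
  finally show ?thesis .
qed

lemma det_block_reflection:
  assumes "P \<subseteq> range lab"
  shows "Determinants.det (block_reflection lab P) = (-1) ^ card P"
proof -
  have "Determinants.det (block_reflection lab P) = (\<Prod>c\<in>range lab. if c \<in> P then -1 else 1)"
    unfolding det_block_diagonal[OF block_reflection_diagonal]
    by (rule prod.cong) (simp_all add: det_restrict_block_reflection)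
  also have "\<dots> = (\<Prod>c\<in>P. -1)"
    using assms(1) by (intro prod.mono_neutral_cong_right) auto
  finally show ?thesis by simp
qed

section \<open>Block-diagonal matrices with special orthogonal blocks\<close>

definition special_block_group :: "('p \<Rightarrow> 'l) \<Rightarrow> (real^'p^'p) set" where
  "special_block_group lab = {R. orthogonal_matrix R \<and> block_diagonal lab R \<and>
     (\<forall>c\<in>range lab. Determinants.det (restrict_matrix (lab -` {c}) R) = 1)}"

lemma det_special_block_group: "R \<in> special_block_group lab \<Longrightarrow> Determinants.det R = 1"
  by (auto simp: special_block_group_def det_block_diagonal[of lab] intro!: prod.neutral)

text \<open>Orthogonal blocks have determinant 1 or \<open>-1\<close>. Since the determinants multiply to 1, the
number of blocks with determinant \<open>-1\<close> is even, and one reflection in each of them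
makes its determinant 1.\<close>

lemma ex_block_reflection_into_special_group:
  fixes R :: "real^'p^'p"
  assumes "orthogonal_matrix R" "block_diagonal lab R" "Determinants.det R = 1"
  obtains P where "P \<subseteq> range lab" "even (card P)"
    "block_reflection lab P ** R \<in> special_block_group lab"
proof -
  let ?d = "\<lambda>c. Determinants.det (restrict_matrix (lab -` {c}) R)"
  define P where "P = {c \<in> range lab. ?d c = -1}"
  have d: "?d c = (if c \<in> P then -1 else 1)" if "c \<in> range lab" for c
    using det_orthogonal_matrix[OF orthogonal_restrict_block[OF assms(2,1)], of c] that
    by (auto simp: P_def)
  have "1 = (\<Prod>c\<in>range lab. if c \<in> P then -1 else 1 :: real)"
    using assms(3) d unfolding det_block_diagonal[OF assms(2)] by simp
  also have "\<dots> = (\<Prod>c\<in>P. -1)"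
    by (intro prod.mono_neutral_cong_right) (auto simp: P_def)
  finally have "even (card P)"
    by (auto simp: minus_one_power_iff split: if_splits)
  moreover have "block_reflection lab P ** R \<in> special_block_group lab"
    using assms d block_reflection_diagonal[of lab P]
    by (auto simp: special_block_group_def block_diagonal_mult orthogonal_matrix_mul
        orthogonal_block_reflection restrict_block_mult Determinants.det_mul
        det_restrict_block_reflection)
  ultimately show ?thesis
    using that[of P] by (auto simp: P_def)
qed

text \<open>The set \<open>P\<close> can be recovered from the product: it consists of the labels of the
blocks of determinant \<open>-1\<close>.\<close>

lemma block_reflection_coset_unique:
  assumes "P \<subseteq> range lab" "P' \<subseteq> range lab"
    and "R \<in> special_block_group lab" "R' \<in> special_block_group lab"
    and "block_reflection lab P ** R = block_reflection lab P' ** R'"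
  shows "P = P'"
proof -
  have sgn: "Determinants.det (restrict_matrix (lab -` {c}) (block_reflection lab P ** R)) =
      (if c \<in> P then -1 else 1)" if "c \<in> range lab" "R \<in> special_block_group lab" for c P R
    using that block_reflection_diagonal[of lab P]
    by (auto simp: special_block_group_def restrict_block_mult Determinants.det_mul
        det_restrict_block_reflection)
  have "c \<in> P \<longleftrightarrow> c \<in> P'" if "c \<in> range lab" for c
    using sgn[OF that assms(3), of P] sgn[OF that assms(4), of P'] assms(5)
    by (auto split: if_splits)
  then show ?thesis using assms(1,2) by blast
qed

lemma closed_special_block_group: "closed (special_block_group lab)"
proof -
  have eq: "special_block_group lab = {R. R\<^sup>T ** R = Finite_Cartesian_Product.mat 1} \<inter>
      (\<Inter>x. \<Inter>y\<in>{y. lab x \<noteq> lab y}. {R. R $ x $ y = 0}) \<inter>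
      (\<Inter>c\<in>range lab. {R. Determinants.det (restrict_matrix (lab -` {c}) R) = 1})"
    by (auto simp: special_block_group_def orthogonal_matrix block_diagonal_def)
  have orth: "closed {R :: real^'p^'p. R\<^sup>T ** R = Finite_Cartesian_Product.mat 1}"
    unfolding matrix_matrix_mult_def Finite_Cartesian_Product.transpose_def
    by (intro closed_Collect_eq continuous_intros)
  have entry: "closed {R :: real^'p^'p. R $ x $ y = 0}" for x y
    by (intro closed_Collect_eq continuous_intros)
  have "continuous_on UNIV (\<lambda>R :: real^'p^'p. restrict_matrix S R $ i $ j)" for S i j
    by (cases "i \<in> S \<and> j \<in> S") (auto intro!: continuous_intros)
  then have det: "closed {R :: real^'p^'p. Determinants.det (restrict_matrix S R) = 1}" for S
    by (intro closed_Collect_eq continuous_on_det continuous_on_const)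
  show ?thesis
    unfolding eq by (rule closed_Int closed_INT ballI orth entry det)+
qed

section \<open>Coordinates on the block group\<close>

text \<open>A choice of coordinates that identifies block-diagonal matrices with lists of square
matrices: \<open>cs\<close> lists the labels, the block with label \<open>cs ! m\<close> has size \<open>ks ! m\<close>, and
\<open>e m\<close> enumerates its indices. The order of \<open>cs\<close> has to match the given order of \<open>ks\<close>.\<close>

locale block_numbering =
  fixes lab :: "'p::finite \<Rightarrow> 'l" and cs :: "'l list" and ks :: "nat list"
    and e :: "nat \<Rightarrow> nat \<Rightarrow> 'p"
  assumes distinct_cs: "distinct cs"
    and set_cs: "set cs = range lab"
    and length_ks: "length ks = length cs"
    and bij_e: "\<And>m. m < length cs \<Longrightarrow> bij_betw (e m) {..<ks ! m} (lab -` {cs ! m})"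
begin

definition blk :: "'p \<Rightarrow> nat" where
  "blk x = (THE m. m < length cs \<and> cs ! m = lab x)"

definition pos :: "'p \<Rightarrow> nat" where
  "pos x = inv_into {..<ks ! blk x} (e (blk x)) x"

lemma blk_eq: "m < length cs \<Longrightarrow> cs ! m = lab x \<Longrightarrow> blk x = m"
  unfolding blk_def by (rule the_equality) (use distinct_cs in \<open>metis nth_eq_iff_index_eq\<close>)+

lemma blk: "blk x < length cs" "cs ! blk x = lab x"
proof -
  have "lab x \<in> set cs" using set_cs by simp
  then obtain m where "m < length cs" "cs ! m = lab x"
    by (auto simp: in_set_conv_nth)
  then show "blk x < length cs" "cs ! blk x = lab x"
    using blk_eq by auto
qed

lemma blk_cong_lab: "blk x = blk y \<longleftrightarrow> lab x = lab y"
  using blk blk_eq by metis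

lemma lab_e: "m < length cs \<Longrightarrow> i < ks ! m \<Longrightarrow> lab (e m i) = cs ! m"
  using bij_e[of m] by (auto simp: bij_betw_def)

lemma blk_e [simp]: "m < length cs \<Longrightarrow> i < ks ! m \<Longrightarrow> blk (e m i) = m"
  using lab_e blk_eq by metis

lemma pos_e [simp]: "m < length cs \<Longrightarrow> i < ks ! m \<Longrightarrow> pos (e m i) = i"
  using bij_e[of m] by (simp add: pos_def bij_betw_def)

lemma pos: "pos x < ks ! blk x" and e_pos [simp]: "e (blk x) (pos x) = x"
proof -
  have "x \<in> e (blk x) ` {..<ks ! blk x}"
    using bij_e[OF blk(1)[of x]] blk(2)[of x] by (simp add: bij_betw_def)
  from inv_into_into[OF this] f_inv_into_f[OF this]
  show "pos x < ks ! blk x" "e (blk x) (pos x) = x"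
    by (simp_all add: pos_def)
qed

lemma blk_pos_inject: "blk x = blk y \<Longrightarrow> pos x = pos y \<Longrightarrow> x = y"
  using e_pos by metis

lemma e_eq_iff:
  "m < length cs \<Longrightarrow> i < ks ! m \<Longrightarrow> j < ks ! m \<Longrightarrow> e m i = e m j \<longleftrightarrow> i = j"
  using pos_e by metis

definition block :: "real^'p^'p \<Rightarrow> nat \<Rightarrow> real mat" where
  "block R m = Matrix.mat (ks ! m) (ks ! m) (\<lambda>(i, j). R $ e m i $ e m j)"

definition blocks :: "real^'p^'p \<Rightarrow> real mat list" where
  "blocks R = map (block R) [0..<length cs]"

definition assemble :: "real mat list \<Rightarrow> real^'p^'p" where
  "assemble As = (\<chi> x y. if blk x = blk y then (As ! blk x) $$ (pos x, pos y) else 0)"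

text \<open>For a block-diagonal \<open>R\<close> the sum over all indices in an inner product of two columns
of one block reduces to the sum over that block. Hence orthogonality of \<open>R\<close> can
be tested block by block.\<close>

lemma gram_block:
  assumes "block_diagonal lab R" "m < length cs" "i < ks ! m" "j < ks ! m"
  shows "(R\<^sup>T ** R) $ e m i $ e m j = (transpose_mat (block R m) * block R m) $$ (i, j)"
proof -
  have "(R\<^sup>T ** R) $ e m i $ e m j = (\<Sum>z\<in>UNIV. R $ z $ e m i * R $ z $ e m j)"
    by (simp add: matrix_matrix_mult_def Finite_Cartesian_Product.transpose_def)
  also have "\<dots> = (\<Sum>z\<in>lab -` {cs ! m}. R $ z $ e m i * R $ z $ e m j)"
    by (rule sum.mono_neutral_right)
       (use assms lab_e in \<open>auto simp: block_diagonal_def\<close>)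
  also have "\<dots> = (\<Sum>l<ks ! m. R $ e m l $ e m i * R $ e m l $ e m j)"
    by (rule sum.reindex_bij_betw[OF bij_e[OF assms(2)], symmetric])
  also have "\<dots> = (transpose_mat (block R m) * block R m) $$ (i, j)"
    using assms by (simp add: block_def scalar_prod_def atLeast0LessThan)
  finally show ?thesis .
qed

lemma orthogonal_block_iff:
  assumes "block_diagonal lab R"
  shows "orthogonal_matrix R \<longleftrightarrow>
    (\<forall>m<length cs. transpose_mat (block R m) * block R m = 1\<^sub>m (ks ! m))"
proof
  assume "orthogonal_matrix R"
  then have RR: "R\<^sup>T ** R = Finite_Cartesian_Product.mat 1"
    by (simp add: orthogonal_matrix)
  show "\<forall>m<length cs. transpose_mat (block R m) * block R m = 1\<^sub>m (ks ! m)"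
  proof (intro allI impI eq_matI)
    fix m i j
    assume "m < length cs" "i < dim_row (1\<^sub>m (ks ! m) :: real mat)" "j < dim_col (1\<^sub>m (ks ! m) :: real mat)"
    then show "(transpose_mat (block R m) * block R m) $$ (i, j) = 1\<^sub>m (ks ! m) $$ (i, j)"
      using gram_block[OF assms, of m i j] RR
      by (simp add: Finite_Cartesian_Product.mat_def e_eq_iff)
  qed (auto simp: block_def)
next
  assume *: "\<forall>m<length cs. transpose_mat (block R m) * block R m = 1\<^sub>m (ks ! m)"
  have "(R\<^sup>T ** R) $ x $ y = Finite_Cartesian_Product.mat 1 $ x $ y" for x y
  proof (cases "lab x = lab y")
    case True
    then show ?thesis
      using gram_block[OF assms blk(1)[of x] pos[of x], of "pos y"] * blk(1)[of x] pos[of x] pos[of y]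
        blk_cong_lab[of x y] e_pos[of y] blk_pos_inject[of x y]
      by (auto simp: Finite_Cartesian_Product.mat_def)
  next
    case False
    then show ?thesis
      using block_diagonal_mult[OF block_diagonal_transpose[OF assms] assms]
      by (auto simp: block_diagonal_def Finite_Cartesian_Product.mat_def)
  qed
  then show "orthogonal_matrix R"
    by (simp add: orthogonal_matrix Finite_Cartesian_Product.vec_eq_iff)
qed

lemma special_block_group_iff:
  assumes "block_diagonal lab R"
  shows "R \<in> special_block_group lab \<longleftrightarrow> blocks R \<in> SO_product ks"
proof -
  have "(\<forall>c\<in>range lab. Determinants.det (restrict_matrix (lab -` {c}) R) = 1) \<longleftrightarrow>
      (\<forall>m<length cs. Determinant.det (block R m) = 1)"
    unfolding set_cs[symmetric] all_set_conv_all_nth block_def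
    by (simp add: det_restrict_matrix[OF bij_e])
  then show ?thesis
    using assms orthogonal_block_iff[OF assms] length_ks
    by (auto simp: special_block_group_def SO_product_def SO_def blocks_def)
       (auto simp: block_def)
qed

lemma assemble_blocks: "block_diagonal lab R \<Longrightarrow> assemble (blocks R) = R"
proof -
  assume R: "block_diagonal lab R"
  have "assemble (blocks R) $ x $ y = R $ x $ y" for x y
  proof (cases "lab x = lab y")
    case True
    then have "blk x = blk y" by (simp add: blk_cong_lab)
    then show ?thesis
      using blk(1)[of x] pos[of x] pos[of y] e_pos[of x] e_pos[of y]
      by (simp add: assemble_def blocks_def block_def)
  next
    case False
    then show ?thesis
      using R by (simp add: assemble_def blk_cong_lab block_diagonal_def)
  qed
  then show ?thesis by (simp add: Finite_Cartesian_Product.vec_eq_iff)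
qed

lemma block_diagonal_assemble: "block_diagonal lab (assemble As)"
  by (simp add: block_diagonal_def assemble_def blk_cong_lab)

lemma blocks_assemble:
  assumes "As \<in> SO_product ks"
  shows "blocks (assemble As) = As"
proof (rule nth_equalityI)
  fix m assume "m < length (blocks (assemble As))"
  then have m: "m < length cs" by (simp add: blocks_def)
  then have "As ! m \<in> carrier_mat (ks ! m) (ks ! m)"
    using assms length_ks by (auto simp: SO_product_def SO_def)
  then show "blocks (assemble As) ! m = As ! m"
    using m by (intro eq_matI) (auto simp: blocks_def block_def assemble_def)
qed (use assms length_ks in \<open>auto simp: SO_product_def blocks_def\<close>)

text \<open>The inverse of the numbering of coordinates that \<open>pad_matrices\<close> uses.\<close>

definition coord :: "nat \<Rightarrow> 'p" where
  "coord = inv_into UNIV (to_nat_on (UNIV :: 'p set))"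

text \<open>The matrix that \<open>assemble\<close> builds from a list, expressed through the padded array of the
list. In this form it is linear on the whole array space, hence smooth.\<close>

definition assemble_padded :: "real^'p^'p^'p \<Rightarrow> real^'p^'p" where
  "assemble_padded A =
     (\<chi> x y. if blk x = blk y then A $ coord (blk x) $ coord (pos x) $ coord (pos y) else 0)"

lemma to_nat_on_coord: "n < CARD('p) \<Longrightarrow> to_nat_on (UNIV :: 'p set) (coord n) = n"
  unfolding coord_def using to_nat_on_finite[of "UNIV :: 'p set"]
  by (intro f_inv_into_f) (simp add: bij_betw_def)

lemma length_cs_le: "length cs \<le> CARD('p)"
  using distinct_cs set_cs card_image_le[of UNIV lab] by (simp flip: distinct_card)

lemma nth_ks_le: "m < length cs \<Longrightarrow> ks ! m \<le> CARD('p)"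
  using bij_betw_same_card[OF bij_e, of m] card_mono[of UNIV "lab -` {cs ! m}"] by simp

lemma assemble_padded_pad:
  assumes "As \<in> SO_product ks"
  shows "assemble_padded (pad_matrices As) = assemble As"
proof -
  have "assemble_padded (pad_matrices As) $ x $ y = assemble As $ x $ y" for x y
  proof (cases "blk x = blk y")
    case True
    have "As ! blk x \<in> carrier_mat (ks ! blk x) (ks ! blk x)" "blk x < length As"
      using assms length_ks blk(1)[of x] by (auto simp: SO_product_def SO_def)
    moreover have "pos x < ks ! blk x" "pos y < ks ! blk x"
      using pos[of x] pos[of y] True by auto
    moreover have "blk x < CARD('p)" "ks ! blk x \<le> CARD('p)"
      using blk(1)[of x] length_cs_le nth_ks_le[of "blk x"] by auto
    ultimately show ?thesis
      using True
      by (simp add: assemble_padded_def assemble_def pad_matrices_def to_nat_on_coord Let_def)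
  qed (simp add: assemble_padded_def assemble_def)
  then show ?thesis by (simp add: Finite_Cartesian_Product.vec_eq_iff)
qed

lemma linear_pad_blocks: "linear (\<lambda>R. pad_matrices (blocks R) :: real^'p^'p^'p)"
proof -
  have nth: "(pad_matrices (blocks R) :: real^'p^'p^'p) $ a $ b $ c =
      (if to_nat_on UNIV a < length cs \<and> to_nat_on UNIV b < ks ! to_nat_on UNIV a \<and>
          to_nat_on UNIV c < ks ! to_nat_on UNIV a
       then R $ e (to_nat_on UNIV a) (to_nat_on UNIV b) $ e (to_nat_on UNIV a) (to_nat_on UNIV c)
       else 0)" for R a b c
    by (cases "to_nat_on UNIV a < length cs") (simp_all add: pad_matrices_def Let_def blocks_def block_def)
  show ?thesis
    by (rule linearI) (simp_all add: Finite_Cartesian_Product.vec_eq_iff nth)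
qed

lemma linear_assemble_padded: "linear assemble_padded"
  by (rule linearI) (auto simp: Finite_Cartesian_Product.vec_eq_iff assemble_padded_def)

text \<open>Left multiplication by \<open>W\<close> is undone by \<open>W\<^sup>T\<close>, so both directions are restrictions of
affine maps that are defined on the whole euclidean space.\<close>

lemma diffeomorphic_block_coset:
  fixes W L :: "real^'p^'p"
  assumes W: "orthogonal_matrix W"
  shows "diffeomorphic ((\<lambda>R. (W ** R, L)) ` special_block_group lab)
    (pad_matrices ` SO_product ks :: (real^'p^'p^'p) set)"
proof -
  let ?F = "\<lambda>z :: (real^'p^'p) \<times> (real^'p^'p). 0 + pad_matrices (blocks (W\<^sup>T ** fst z)) :: real^'p^'p^'p"
  let ?G = "\<lambda>A :: real^'p^'p^'p. (0, L) + (W ** assemble_padded A, 0)"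
  have WW: "W\<^sup>T ** (W ** R) = R" for R :: "real^'p^'p"
    using W by (simp add: orthogonal_matrix matrix_mul_assoc)
  have linmul: "linear (\<lambda>R :: real^'p^'p. B ** R)" for B
    by (rule linearI) (simp_all add: matrix_add_ldistrib matrix_scalar_ac
        scalar_matrix_assoc flip: scalar_mult_eq_scaleR)
  have "linear (\<lambda>z :: (real^'p^'p) \<times> (real^'p^'p). pad_matrices (blocks (W\<^sup>T ** fst z)) :: real^'p^'p^'p)"
    using linear_compose[OF linear_compose[OF linear_fst linmul] linear_pad_blocks] by (simp add: o_def)
  then have smF: "smooth_on S ?F" for S
    by (intro smooth_on_affine) (simp add: linear_conv_bounded_linear)
  have "bounded_linear (\<lambda>A. W ** assemble_padded A)"
    using linear_compose[OF linear_assemble_padded linmul[of W]]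
    by (simp add: o_def linear_conv_bounded_linear)
  then have smG: "smooth_on S ?G" for S
    by (intro smooth_on_affine bounded_linear_Pair bounded_linear_zero)
  have to: "blocks R \<in> SO_product ks" "assemble (blocks R) = R" if "R \<in> special_block_group lab" for R
    using that special_block_group_iff assemble_blocks by (auto simp: special_block_group_def)
  have onto: "assemble As \<in> special_block_group lab" if "As \<in> SO_product ks" for As
    using that by (simp add: special_block_group_iff block_diagonal_assemble blocks_assemble)
  show ?thesis
    unfolding diffeomorphic_def diffeomorphism_def
  proof (intro exI conjI)
    let ?S = "(\<lambda>R. (W ** R, L)) ` special_block_group lab"
    let ?Q = "pad_matrices ` SO_product ks :: (real^'p^'p^'p) set"
    show "smooth_on ?S ?F" "smooth_on ?Q ?G"
      by (rule smF smG)+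
    have F: "?F z \<in> ?Q" "?G (?F z) = z" if "z \<in> ?S" for z
      using that to by (auto simp: WW assemble_padded_pad)
    have G: "?G A \<in> ?S" "?F (?G A) = A" if "A \<in> ?Q" for A
      using that onto by (auto simp: WW assemble_padded_pad blocks_assemble)
    show "\<forall>z\<in>?S. ?G (?F z) = z" "\<forall>A\<in>?Q. ?F (?G A) = A"
      using F G by blast+
    show "?F ` ?S = ?Q"
    proof (intro equalityI subsetI)
      fix A assume "A \<in> ?Q"
      then show "A \<in> ?F ` ?S" by (intro image_eqI[of A ?F "?G A"]) (use G in simp_all)
    qed (use F in blast)
    show "?G ` ?Q = ?S"
    proof (intro equalityI subsetI)
      fix z assume "z \<in> ?S"
      then show "z \<in> ?G ` ?Q" by (intro image_eqI[of z ?G "?F z"]) (use F in simp_all)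
    qed (use G in blast)
  qed
qed

end

lemma closed_block_coset:
  fixes W L :: "real^'p^'p"
  assumes W: "orthogonal_matrix W"
  shows "closed ((\<lambda>R. (W ** R, L)) ` special_block_group lab)"
proof -
  have WW: "W\<^sup>T ** (W ** R) = R" "W ** (W\<^sup>T ** R) = R" for R :: "real^'p^'p"
    using W by (simp_all add: orthogonal_matrix_def matrix_mul_assoc)
  have "(\<lambda>R. (W ** R, L)) ` special_block_group lab =
      (\<lambda>z. W\<^sup>T ** fst z) -` special_block_group lab \<inter> UNIV \<times> {L}"
  proof (intro equalityI subsetI)
    fix z assume "z \<in> (\<lambda>z. W\<^sup>T ** fst z) -` special_block_group lab \<inter> UNIV \<times> {L}"
    then show "z \<in> (\<lambda>R. (W ** R, L)) ` special_block_group lab"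
      by (intro image_eqI[where x = "W\<^sup>T ** fst z"]) (auto simp: WW)
  qed (auto simp: WW)
  moreover have "continuous_on UNIV (\<lambda>z :: (real^'p^'p) \<times> (real^'p^'p). W\<^sup>T ** fst z)"
    unfolding matrix_matrix_mult_def by (intro continuous_intros)
  ultimately show ?thesis
    by (auto intro!: closed_Int closed_vimage closed_special_block_group closed_Times)
qed

text \<open>The multiplicities of the labels determine \<open>ks\<close> only up to order, so the list of labels
is permuted until the multiplicities appear in the order of \<open>ks\<close>.\<close>

lemma ex_block_numbering:
  fixes lab :: "'p::finite \<Rightarrow> 'l"
  assumes "mset ks = image_mset (\<lambda>c. card (lab -` {c})) (mset_set (range lab))"
  obtains cs e where "block_numbering lab cs ks e"
proof -
  obtain cs0 where cs0: "mset cs0 = mset_set (range lab)"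
    using ex_mset by blast
  have "mset ks = mset (map (\<lambda>c. card (lab -` {c})) cs0)"
    using assms cs0 by simp
  then obtain p where p: "p permutes {..<length cs0}"
      "ks = permute_list p (map (\<lambda>c. card (lab -` {c})) cs0)"
    using mset_eq_permutation by (metis length_map)
  define cs where "cs = permute_list p cs0"
  have ks: "ks = map (\<lambda>c. card (lab -` {c})) cs"
    using p by (simp add: cs_def permute_list_map)
  have mset_cs: "mset cs = mset_set (range lab)"
    using p cs0 by (simp add: cs_def)
  have set_cs: "set cs = range lab"
    using arg_cong[OF mset_cs, of set_mset] by simp
  moreover have "distinct cs"
    by (simp add: distinct_count_atmost_1 mset_cs set_cs count_mset_set')
  moreover have "\<exists>f. bij_betw f {..<card (lab -` {c})} (lab -` {c})" for c
    using ex_bij_betw_nat_finite[of "lab -` {c}"] by (simp add: atLeast0LessThan)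
  then obtain f where "\<And>c. bij_betw (f c) {..<card (lab -` {c})} (lab -` {c})"
    by metis
  ultimately have "block_numbering lab cs ks (\<lambda>m. f (cs ! m))"
    by unfold_locales (simp_all add: ks)
  then show thesis by (rule that)
qed

section \<open>Counting rearrangements and sign patterns\<close>

text \<open>Fix \<open>a \<in> A\<close>. An even subset of \<open>A\<close> is determined by its intersection with \<open>A - {a}\<close>,
which is arbitrary: whether \<open>a\<close> belongs to the subset is decided by parity.\<close>

lemma card_even_subsets:
  assumes "finite A" "A \<noteq> {}"
  shows "card {P. P \<subseteq> A \<and> even (card P)} = 2 ^ (card A - 1)"
proof -
  obtain a where a: "a \<in> A" using assms(2) by blast
  let ?E = "{P. P \<subseteq> A \<and> even (card P)}"
  define g where "g Q = (if even (card Q) then Q else insert a Q)" for Q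
  have "bij_betw (\<lambda>P. P - {a}) ?E (Pow (A - {a}))"
  proof (rule bij_betw_byWitness[where f' = g])
    show "\<forall>P\<in>?E. g (P - {a}) = P"
    proof
      fix P assume P: "P \<in> ?E"
      then have "finite P" using assms(1) finite_subset by blast
      show "g (P - {a}) = P"
      proof (cases "a \<in> P")
        case True
        then have "card P = Suc (card (P - {a}))"
          using \<open>finite P\<close> by (rule card.remove[rotated])
        then show ?thesis using P True by (auto simp: g_def)
      qed (use P in \<open>simp add: g_def\<close>)
    qed
    have "g Q \<in> ?E" if "Q \<subseteq> A - {a}" for Q
    proof -
      have "finite Q" "a \<notin> Q" "Q \<subseteq> A"
        using that assms(1) finite_subset[of Q A] by auto
      then show ?thesis using a by (simp add: g_def)
    qed
    then show "g ` Pow (A - {a}) \<subseteq> ?E" by blast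
  qed (auto simp: g_def)
  then have "card ?E = card (Pow (A - {a}))"
    by (rule bij_betw_same_card)
  then show ?thesis
    using assms(1) a by (simp add: card_Pow)
qed

lemma count_image_mset_set_UNIV:
  "count (image_mset f (mset_set (UNIV :: 'a::finite set))) c = card (f -` {c})"
  by (simp add: count_image_mset)

text \<open>Listing the values along an enumeration of the domain identifies these functions
with the permutations of the multiset of values of \<open>g\<close>, which the multinomial
coefficient counts.\<close>

lemma card_functions_same_fibers:
  fixes g :: "'a::finite \<Rightarrow> 'b"
  shows "card {f :: 'a \<Rightarrow> 'b. \<forall>c. card (f -` {c}) = card (g -` {c})} =
    fact CARD('a) div (\<Prod>c\<in>range g. fact (card (g -` {c})))" (is "card ?F = _")
proof -
  let ?n = "CARD('a)"
  let ?M = "image_mset g (mset_set UNIV)"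
  obtain h :: "nat \<Rightarrow> 'a" where h: "bij_betw h {0..<?n} UNIV"
    using ex_bij_betw_nat_finite[of "UNIV :: 'a set"] by auto
  let ?list = "\<lambda>f :: 'a \<Rightarrow> 'b. map (\<lambda>i. f (h i)) [0..<?n]"
  have mset_list: "mset (?list f) = image_mset f (mset_set UNIV)" for f
  proof -
    have "mset (?list f) = image_mset f (image_mset h (mset_set {0..<?n}))"
      by (simp add: image_mset.compositionality o_def)
    then show ?thesis
      using h by (simp add: image_mset_mset_set bij_betw_def)
  qed
  have "bij_betw ?list ?F (permutations_of_multiset ?M)"
  proof (rule bij_betwI')
    fix f f' :: "'a \<Rightarrow> 'b"
    have "f = f'" if "?list f = ?list f'"
    proof
      fix x
      have "x \<in> h ` {0..<?n}"
        using h by (simp add: bij_betw_def)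
      then show "f x = f' x" using that by (auto simp: map_eq_conv)
    qed
    then show "?list f = ?list f' \<longleftrightarrow> f = f'" by auto
  next
    fix f assume "f \<in> ?F"
    then have "mset (?list f) = ?M"
      unfolding mset_list by (simp add: multiset_eq_iff count_image_mset_set_UNIV)
    then show "?list f \<in> permutations_of_multiset ?M"
      by (rule permutations_of_multisetI)
  next
    fix xs assume xs: "xs \<in> permutations_of_multiset ?M"
    then have mset_xs: "mset xs = ?M" by (rule permutations_of_multisetD)
    then have len: "length xs = ?n"
      by (metis size_image_mset size_mset size_mset_set)
    define f where "f x = xs ! inv_into {0..<?n} h x" for x
    have "?list f = xs"
      using h len by (intro nth_equalityI) (auto simp: f_def bij_betw_def)
    moreover have "image_mset f (mset_set UNIV) = ?M"
      using mset_list[of f] unfolding \<open>?list f = xs\<close> mset_xs by simp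
    then have "f \<in> ?F"
      by (simp flip: count_image_mset_set_UNIV)
    ultimately show "\<exists>f\<in>?F. xs = ?list f" by (metis (no_types, lifting))
  qed
  then have "card ?F = card (permutations_of_multiset ?M)"
    by (rule bij_betw_same_card)
  also have "\<dots> = fact ?n div (\<Prod>c\<in>range g. fact (card (g -` {c})))"
    unfolding card_permutations_of_multiset by (simp add: count_image_mset_set_UNIV)
  finally show ?thesis .
qed

lemma same_fiber_cards_imp_range_eq:
  fixes l d :: "'p::finite \<Rightarrow> 'b"
  assumes "\<And>c. card (l -` {c}) = card (d -` {c})"
  shows "range l = range d"
proof -
  have nonempty: "c \<in> range f \<longleftrightarrow> card (f -` {c}) \<noteq> 0" for c and f :: "'p \<Rightarrow> 'b"
    by (auto simp: card_eq_0_iff)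
  show ?thesis
  proof (rule Set.set_eqI)
    show "c \<in> range l \<longleftrightarrow> c \<in> range d" for c
      unfolding nonempty assms ..
  qed
qed

section \<open>Diagonalizations of one symmetric matrix\<close>

definition diagonal_matrix :: "('p \<Rightarrow> real) \<Rightarrow> real^'p^'p" where
  "diagonal_matrix d = (\<chi> i j. if i = j then d i else 0)"

lemma matrix_mult_diagonal:
  fixes A :: "real^'p^'p"
  shows
  "(A ** diagonal_matrix d) $ i $ j = A $ i $ j * d j"
  "(diagonal_matrix d ** A) $ i $ j = d i * A $ i $ j"
  by (simp_all add: matrix_matrix_mult_def diagonal_matrix_def if_distrib[of "\<lambda>c. _ * c"]
      if_distrib[of "\<lambda>c. c * _"] cong: if_cong)

lemma conjugate_diagonal_nth:
  fixes A :: "real^'p^'p"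
  shows "(A ** diagonal_matrix d ** A\<^sup>T) $ i $ j = (\<Sum>k\<in>UNIV. A $ i $ k * d k * A $ j $ k)"
  unfolding matrix_matrix_mult_def[of "A ** diagonal_matrix d"]
  by (simp add: matrix_mult_diagonal Finite_Cartesian_Product.transpose_def)

lemma commute_diagonal_iff:
  fixes A :: "real^'p^'p"
  shows "A ** diagonal_matrix d = diagonal_matrix d ** A \<longleftrightarrow> block_diagonal d A"
  by (auto simp: Finite_Cartesian_Product.vec_eq_iff matrix_mult_diagonal block_diagonal_def)
     (metis mult.commute)

text \<open>For diagonal \<open>A\<close> and \<open>B\<close>: two diagonalizations of one matrix differ by an orthogonal
matrix \<open>W\<^sup>T V\<close> that intertwines the diagonal matrices.\<close>

lemma orthogonal_conjugate_eq_iff: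
  fixes V W A B :: "real^'p^'p"
  assumes "orthogonal_matrix V" "orthogonal_matrix W"
  shows "V ** A ** V\<^sup>T = W ** B ** W\<^sup>T \<longleftrightarrow> (W\<^sup>T ** V) ** A = B ** (W\<^sup>T ** V)"
proof
  assume eq: "V ** A ** V\<^sup>T = W ** B ** W\<^sup>T"
  have "(W\<^sup>T ** V) ** A = W\<^sup>T ** (V ** A ** V\<^sup>T) ** V"
    using assms(1) by (simp add: orthogonal_matrix_def flip: matrix_mul_assoc)
  also have "\<dots> = W\<^sup>T ** W ** B ** (W\<^sup>T ** V)"
    unfolding eq by (simp add: matrix_mul_assoc)
  finally show "(W\<^sup>T ** V) ** A = B ** (W\<^sup>T ** V)"
    using assms(2) by (simp add: orthogonal_matrix_def)
next
  assume eq: "(W\<^sup>T ** V) ** A = B ** (W\<^sup>T ** V)"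
  have "V ** A ** V\<^sup>T = (W ** W\<^sup>T) ** V ** A ** V\<^sup>T"
    using assms(2) by (simp add: orthogonal_matrix_def)
  also have "\<dots> = W ** ((W\<^sup>T ** V) ** A) ** V\<^sup>T"
    by (simp add: matrix_mul_assoc)
  also have "\<dots> = W ** B ** W\<^sup>T ** (V ** V\<^sup>T)"
    unfolding eq by (simp add: matrix_mul_assoc)
  finally show "V ** A ** V\<^sup>T = W ** B ** W\<^sup>T"
    using assms(1) by (simp add: orthogonal_matrix_def)
qed

lemma orthogonal_sum_squares:
  fixes R :: "real^'p^'p"
  assumes "orthogonal_matrix R"
  shows "(\<Sum>j\<in>UNIV. (R $ i $ j)\<^sup>2) = 1" "(\<Sum>i\<in>UNIV. (R $ i $ j)\<^sup>2) = 1"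
proof -
  have "(R ** R\<^sup>T) $ i $ i = 1" "(R\<^sup>T ** R) $ j $ j = 1"
    using assms by (simp_all add: orthogonal_matrix_def Finite_Cartesian_Product.mat_def)
  then show "(\<Sum>j\<in>UNIV. (R $ i $ j)\<^sup>2) = 1" "(\<Sum>i\<in>UNIV. (R $ i $ j)\<^sup>2) = 1"
    by (simp_all add: matrix_matrix_mult_def Finite_Cartesian_Product.transpose_def power2_eq_square)
qed

text \<open>Let \<open>R = U\<^sup>T V\<close>. The squares \<open>R\<^sub>i\<^sub>j\<^sup>2\<close> have all row sums and column sums equal to 1 and vanish
unless \<open>l\<^sub>j = d\<^sub>i\<close>. Summing them over the columns with \<open>l\<^sub>j = c\<close> gives the same as
summing them over the rows with \<open>d\<^sub>i = c\<close>.\<close>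

lemma orthogonal_similar_diagonal_multiplicities:
  fixes V U :: "real^'p^'p"
  assumes "orthogonal_matrix V" "orthogonal_matrix U"
    and "V ** diagonal_matrix l ** V\<^sup>T = U ** diagonal_matrix d ** U\<^sup>T"
  shows "card (l -` {c}) = card (d -` {c})"
proof -
  define R where "R = U\<^sup>T ** V"
  have R: "orthogonal_matrix R"
    using assms(1,2) by (simp add: R_def orthogonal_matrix_mul)
  have "R ** diagonal_matrix l = diagonal_matrix d ** R"
    using assms(3) orthogonal_conjugate_eq_iff[OF assms(1,2)] by (simp add: R_def)
  then have "R $ i $ j * l j = d i * R $ i $ j" for i j
    by (metis matrix_mult_diagonal)
  then have same: "l j = d i" if "R $ i $ j \<noteq> 0" for i j
    using that by (metis mult.commute mult_right_cancel)
  have "real (card (l -` {c})) = (\<Sum>j\<in>UNIV. of_bool (l j = c) * (\<Sum>i\<in>UNIV. (R $ i $ j)\<^sup>2))"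
    by (simp add: orthogonal_sum_squares[OF R] vimage_def flip: sum.inter_filter)
  also have "\<dots> = (\<Sum>j\<in>UNIV. \<Sum>i\<in>UNIV. of_bool (d i = c) * (R $ i $ j)\<^sup>2)"
    unfolding sum_distrib_left by (intro sum.cong refl) (use same in auto)
  also have "\<dots> = (\<Sum>i\<in>UNIV. of_bool (d i = c) * (\<Sum>j\<in>UNIV. (R $ i $ j)\<^sup>2))"
    by (subst sum.swap) (simp add: sum_distrib_left)
  also have "\<dots> = real (card (d -` {c}))"
    by (simp add: orthogonal_sum_squares[OF R] vimage_def flip: sum.inter_filter)
  finally show ?thesis by simp
qed

text \<open>Permuting the columns of \<open>U\<close> together with the diagonal entries leaves the product
unchanged. So does negating a column, which is used to reach determinant 1.\<close>

lemma rotation_diagonalizes_permuted: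
  fixes U :: "real^'p^'p" and l d :: "'p \<Rightarrow> real"
  assumes U: "orthogonal_matrix U" and mult: "\<And>c. card (l -` {c}) = card (d -` {c})"
  obtains W where "rotation_matrix W"
    "W ** diagonal_matrix l ** W\<^sup>T = U ** diagonal_matrix d ** U\<^sup>T"
proof -
  have "image_mset l (mset_set UNIV) = image_mset d (mset_set UNIV)"
    by (simp add: multiset_eq_iff count_image_mset_set_UNIV mult)
  then obtain p where p: "p permutes UNIV" and ld: "\<And>i. l i = d (p i)"
    using image_mset_eq_implies_permutes[of UNIV l d] by auto
  define W0 :: "real^'p^'p" where "W0 = (\<chi> a i. U $ a $ p i)"
  have reindex: "(\<Sum>i\<in>UNIV. f (p i)) = (\<Sum>i\<in>UNIV. f i)" for f :: "'p \<Rightarrow> real"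
    using sum.permute[OF p, of f] by (simp add: o_def)
  have "W0 ** W0\<^sup>T = U ** U\<^sup>T"
    by (simp add: Finite_Cartesian_Product.vec_eq_iff matrix_matrix_mult_def
        Finite_Cartesian_Product.transpose_def W0_def reindex[of "\<lambda>i. U $ _ $ i * U $ _ $ i"])
  then have W0: "orthogonal_matrix W0"
    using U matrix_left_right_inverse by (auto simp: orthogonal_matrix_def)
  have conj: "W0 ** diagonal_matrix l ** W0\<^sup>T = U ** diagonal_matrix d ** U\<^sup>T"
    by (simp add: Finite_Cartesian_Product.vec_eq_iff conjugate_diagonal_nth W0_def ld
        reindex[of "\<lambda>i. U $ _ $ i * d i * U $ _ $ i"])
  obtain c where c: "c \<in> range l" by blast
  let ?B = "block_reflection l {c}"
  consider "Determinants.det W0 = 1" | "Determinants.det W0 = -1"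
    using det_orthogonal_matrix[OF W0] by blast
  then show thesis
  proof cases
    case 1
    then show thesis using that[of W0] W0 conj by (simp add: rotation_matrix_def)
  next
    case 2
    \<comment> \<open>The reflection commutes with the diagonal matrix, so it cancels in the conjugation.\<close>
    have "W0\<^sup>T ** (W0 ** ?B) = ?B"
      using W0 by (simp add: orthogonal_matrix matrix_mul_assoc)
    then have "(W0 ** ?B) ** diagonal_matrix l ** (W0 ** ?B)\<^sup>T = W0 ** diagonal_matrix l ** W0\<^sup>T"
      using W0 orthogonal_block_reflection[of l "{c}"]
      by (simp add: orthogonal_conjugate_eq_iff orthogonal_matrix_mul
          commute_diagonal_iff block_reflection_diagonal)
    moreover have "rotation_matrix (W0 ** ?B)"
      using 2 c W0 by (simp add: rotation_matrix_def orthogonal_matrix_mul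
          orthogonal_block_reflection Determinants.det_mul det_block_reflection)
    ultimately show thesis using that conj by simp
  qed
qed

section \<open>The fibre as a union of cosets\<close>

lemma Diag_pos_iff: "L \<in> Diag_pos \<longleftrightarrow> (\<exists>l. L = diagonal_matrix l \<and> (\<forall>i. l i > 0))"
proof
  assume L: "L \<in> Diag_pos"
  then have "L = diagonal_matrix (\<lambda>i. L $ i $ i)"
    by (auto simp: Diag_pos_def Finite_Cartesian_Product.vec_eq_iff diagonal_matrix_def)
  moreover have "\<forall>i. L $ i $ i > 0" using L by (simp add: Diag_pos_def)
  ultimately show "\<exists>l. L = diagonal_matrix l \<and> (\<forall>i. l i > 0)"
    by (intro exI[of _ "\<lambda>i. L $ i $ i"]) simp
qed (auto simp: Diag_pos_def diagonal_matrix_def)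

lemma diagonal_matrix_inject [simp]: "diagonal_matrix l = diagonal_matrix d \<longleftrightarrow> l = d"
proof
  assume eq: "diagonal_matrix l = diagonal_matrix d"
  have "l i = d i" for i
    using arg_cong[OF eq, of "\<lambda>A. A $ i $ i"] by (simp add: diagonal_matrix_def)
  then show "l = d" by (rule ext)
qed simp

lemma mem_eigen_fiber_iff:
  "(V, L) \<in> eigen_fiber X \<longleftrightarrow> rotation_matrix V \<and> L \<in> Diag_pos \<and> V ** L ** V\<^sup>T = X"
  by (simp add: eigen_fiber_def M_space_def eigen_map_def)

text \<open>The functions that arise from \<open>d\<close> by permuting the arguments, described by how often
they take each value.\<close>

definition rearrangements :: "('p \<Rightarrow> real) \<Rightarrow> ('p \<Rightarrow> real) set" where
  "rearrangements d = {l. \<forall>c. card (l -` {c}) = card (d -` {c})}"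

text \<open>A connected component of the fibre, when \<open>W\<close> is a rotation that diagonalizes \<open>X\<close> with
eigenvalues \<open>l\<close> and \<open>P\<close> is an even set of eigenvalues.\<close>

definition fiber_piece :: "real^'p^'p \<Rightarrow> ('p \<Rightarrow> real) \<Rightarrow> real set \<Rightarrow> ((real^'p^'p) \<times> (real^'p^'p)) set" where
  "fiber_piece W l P =
     (\<lambda>R. (W ** block_reflection l P ** R, diagonal_matrix l)) ` special_block_group l"

definition piece_indices :: "('p \<Rightarrow> real) \<Rightarrow> (('p \<Rightarrow> real) \<times> real set) set" where
  "piece_indices d = rearrangements d \<times> {P. P \<subseteq> range d \<and> even (card P)}"

lemma range_rearrangement: "l \<in> rearrangements d \<Longrightarrow> range l = range (d :: 'p::finite \<Rightarrow> real)"
  by (rule same_fiber_cards_imp_range_eq) (simp add: rearrangements_def)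

lemma finite_rearrangements:
  fixes d :: "'p::finite \<Rightarrow> real"
  shows "finite (rearrangements d)"
proof (rule finite_subset)
  show "rearrangements d \<subseteq> Pi\<^sub>E UNIV (\<lambda>_. range d)"
  proof
    fix l assume "l \<in> rearrangements d"
    then have "l i \<in> range d" for i
      using range_rearrangement[of l d] by (metis rangeI)
    then show "l \<in> Pi\<^sub>E UNIV (\<lambda>_. range d)"
      by (auto simp: PiE_def Pi_def extensional_def)
  qed
qed (simp add: finite_PiE)

text \<open>Given \<open>V\<close> in the fibre over \<open>l\<close>, the matrix \<open>R = W\<^sub>l\<^sup>T V\<close> is a rotation commuting with
\<open>diag l\<close>, so \<open>E\<^sub>P R\<close> has special orthogonal blocks for some even \<open>P\<close>. As \<open>E\<^sub>P\<close> is an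
involution, \<open>V = W\<^sub>l E\<^sub>P (E\<^sub>P R)\<close>.\<close>

lemma eigen_fiber_eq_Union_fiber_pieces:
  fixes d :: "'p::finite \<Rightarrow> real"
  assumes Ud: "(U, diagonal_matrix d) \<in> eigen_fiber X"
    and W: "\<And>l. l \<in> rearrangements d \<Longrightarrow> rotation_matrix (W l)"
    and WX: "\<And>l. l \<in> rearrangements d \<Longrightarrow> W l ** diagonal_matrix l ** (W l)\<^sup>T = X"
  shows "eigen_fiber X = (\<Union>(l, P)\<in>piece_indices d. fiber_piece (W l) l P)"
proof (intro equalityI subsetI)
  fix z assume "z \<in> eigen_fiber X"
  then obtain V l where z: "z = (V, diagonal_matrix l)" and V: "rotation_matrix V"
    and VX: "V ** diagonal_matrix l ** V\<^sup>T = X"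
    by (cases z) (auto simp: mem_eigen_fiber_iff Diag_pos_iff)
  have oV: "orthogonal_matrix V" and dV: "Determinants.det V = 1"
    using V by (auto simp: rotation_matrix_def)
  have "orthogonal_matrix U" "U ** diagonal_matrix d ** U\<^sup>T = X"
    using Ud by (auto simp: mem_eigen_fiber_iff rotation_matrix_def)
  then have l: "l \<in> rearrangements d"
    using orthogonal_similar_diagonal_multiplicities[OF oV] VX by (auto simp: rearrangements_def)
  have oW: "orthogonal_matrix (W l)" and dW: "Determinants.det (W l) = 1"
    using W[OF l] by (auto simp: rotation_matrix_def)
  let ?R = "(W l)\<^sup>T ** V"
  have "block_diagonal l ?R"
    using orthogonal_conjugate_eq_iff[OF oV oW] VX WX[OF l] commute_diagonal_iff by metis
  moreover have "orthogonal_matrix ?R" "Determinants.det ?R = 1"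
    using oV oW dV dW by (simp_all add: orthogonal_matrix_mul Determinants.det_mul)
  ultimately obtain P where P: "P \<subseteq> range l" "even (card P)"
      "block_reflection l P ** ?R \<in> special_block_group l"
    using ex_block_reflection_into_special_group by metis
  have "W l ** block_reflection l P ** (block_reflection l P ** ?R) =
      W l ** (block_reflection l P ** block_reflection l P) ** (W l)\<^sup>T ** V"
    by (simp only: matrix_mul_assoc)
  also have "\<dots> = V"
    using oW by (simp add: block_reflection_square orthogonal_matrix_def)
  finally have "z \<in> fiber_piece (W l) l P"
    unfolding fiber_piece_def z using P(3) by (intro image_eqI[of _ _ "block_reflection l P ** ?R"]) auto
  moreover have "(l, P) \<in> piece_indices d"
    using l P range_rearrangement[OF l] by (simp add: piece_indices_def)
  ultimately show "z \<in> (\<Union>(l, P)\<in>piece_indices d. fiber_piece (W l) l P)"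
    by auto
next
  fix z assume "z \<in> (\<Union>(l, P)\<in>piece_indices d. fiber_piece (W l) l P)"
  then obtain l P R where z: "z = (W l ** block_reflection l P ** R, diagonal_matrix l)"
      and lP: "(l, P) \<in> piece_indices d" and R: "R \<in> special_block_group l"
    by (auto simp: fiber_piece_def)
  have l: "l \<in> rearrangements d" and P: "P \<subseteq> range l" "even (card P)"
    using lP range_rearrangement[of l d] by (auto simp: piece_indices_def)
  have oW: "orthogonal_matrix (W l)" and dW: "Determinants.det (W l) = 1"
    using W[OF l] by (auto simp: rotation_matrix_def)
  have oR: "orthogonal_matrix R" "block_diagonal l R"
    using R by (auto simp: special_block_group_def)
  let ?V = "W l ** block_reflection l P ** R"
  have oV: "orthogonal_matrix ?V"
    by (intro orthogonal_matrix_mul oW oR orthogonal_block_reflection)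
  have "(W l)\<^sup>T ** ?V = block_reflection l P ** R"
    using oW by (simp add: matrix_mul_assoc orthogonal_matrix)
  then have "?V ** diagonal_matrix l ** ?V\<^sup>T = X"
    unfolding WX[OF l, symmetric] orthogonal_conjugate_eq_iff[OF oV oW]
    by (simp add: commute_diagonal_iff block_diagonal_mult block_reflection_diagonal oR)
  moreover have "rotation_matrix ?V"
    using oV dW P R
    by (simp add: rotation_matrix_def Determinants.det_mul det_block_reflection det_special_block_group)
  moreover have "\<forall>i. l i > 0"
  proof
    fix i
    obtain j where "l i = d j" using range_rearrangement[OF l] by (metis rangeE rangeI)
    then show "l i > 0" using Ud by (auto simp: mem_eigen_fiber_iff Diag_pos_iff)
  qed
  ultimately show "z \<in> eigen_fiber X"
    unfolding z mem_eigen_fiber_iff Diag_pos_iff by blast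
qed

lemma disjoint_fiber_pieces:
  fixes d :: "'p::finite \<Rightarrow> real"
  assumes W: "\<And>l. l \<in> rearrangements d \<Longrightarrow> orthogonal_matrix (W l)"
  shows "disjoint_family_on (\<lambda>(l, P). fiber_piece (W l) l P) (piece_indices d)"
proof -
  have "(l, P) = (l', P')"
    if lP: "(l, P) \<in> piece_indices d" "(l', P') \<in> piece_indices d"
      and z: "z \<in> fiber_piece (W l) l P" "z \<in> fiber_piece (W l') l' P'" for l P l' P' z
  proof -
    have l: "l' = l" using z by (auto simp: fiber_piece_def)
    obtain R R' where R: "R \<in> special_block_group l" "R' \<in> special_block_group l"
      and eq: "W l ** block_reflection l P ** R = W l ** block_reflection l P' ** R'"
      using z by (auto simp: fiber_piece_def l)
    have "(W l)\<^sup>T ** W l = Finite_Cartesian_Product.mat 1"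
      using W lP by (auto simp: piece_indices_def orthogonal_matrix)
    then have "block_reflection l P ** R = block_reflection l P' ** R'"
      using arg_cong[OF eq, of "\<lambda>A. (W l)\<^sup>T ** A"] by (simp add: matrix_mul_assoc)
    moreover have "P \<subseteq> range l" "P' \<subseteq> range l"
      using lP range_rearrangement[of l d] by (auto simp: piece_indices_def l)
    ultimately show ?thesis
      using block_reflection_coset_unique R l by blast
  qed
  then show ?thesis
    unfolding disjoint_family_on_def by (auto simp: disjoint_iff) blast+
qed

text \<open>The blocks of the partition are the level sets of \<open>d\<close>, one for each value.\<close>

lemma mset_multiplicities:
  fixes d :: "'p::finite \<Rightarrow> real"
  shows "partition_type (diag_partition (diagonal_matrix d)) =
    image_mset (\<lambda>c. card (d -` {c})) (mset_set (range d))"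
proof -
  have "{(i, j). d i = d j} `` {x} = d -` {d x}" for x by auto
  then have "diag_partition (diagonal_matrix d) = (\<lambda>c. d -` {c}) ` range d"
    by (auto simp: diag_partition_def quotient_def diagonal_matrix_def)
  moreover have "inj_on (\<lambda>c. d -` {c}) (range d)"
    by (auto simp: inj_on_def)
  ultimately show ?thesis
    by (simp add: partition_type_def image_mset.compositionality o_def flip: image_mset_mset_set)
qed

lemma card_piece_indices:
  fixes d :: "'p::finite \<Rightarrow> real"
  assumes "mset ks = partition_type (diag_partition (diagonal_matrix d))"
  shows "card (piece_indices d) =
    2 ^ (length ks - 1) * (fact CARD('p) div prod_list (map fact ks))"
proof -
  note ks = assms[unfolded mset_multiplicities]
  have "length ks = card (range d)"
    using arg_cong[OF ks, of size] by simp
  moreover have "prod_list (map fact ks) = (\<Prod>c\<in>range d. fact (card (d -` {c})) :: nat)"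
  proof -
    have "prod_list (map fact ks) = prod_mset (image_mset fact (mset ks) :: nat multiset)"
      by (simp flip: prod_mset_prod_list)
    then show ?thesis
      unfolding ks by (simp add: image_mset.compositionality o_def prod_unfold_prod_mset)
  qed
  ultimately show ?thesis
    by (simp add: piece_indices_def card_cartesian_product rearrangements_def
        card_functions_same_fibers card_even_subsets)
qed

section \<open>Diffeomorphism type of the fibre\<close>

theorem corollaryA7:
  fixes X U D :: "real^'p^'p" and ks :: "nat list"
  assumes "CARD('p) \<ge> 2"
    and "X \<in> Sym_pos"
    and "(U, D) \<in> eigen_fiber X"
    and "mset ks = partition_type (diag_partition D)"
  shows "diffeomorphic (eigen_fiber X)
           (disjoint_copies
              (2 ^ (length ks - 1) * (fact CARD('p) div prod_list (map fact ks)))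
              (pad_matrices ` SO_product ks :: (real^'p^'p^'p) set))"
proof -
  obtain d where D: "D = diagonal_matrix d"
    using assms(3) by (auto simp: mem_eigen_fiber_iff Diag_pos_iff)
  note Ud = assms(3)[unfolded D] and ks = assms(4)[unfolded D]
  have U: "orthogonal_matrix U" "U ** diagonal_matrix d ** U\<^sup>T = X"
    using Ud by (auto simp: mem_eigen_fiber_iff rotation_matrix_def)
  have "\<exists>W. rotation_matrix W \<and> W ** diagonal_matrix l ** W\<^sup>T = X" if "l \<in> rearrangements d" for l
    using rotation_diagonalizes_permuted[OF U(1), of l d] that U(2)
    unfolding rearrangements_def by blast
  then obtain W where W: "\<And>l. l \<in> rearrangements d \<Longrightarrow> rotation_matrix (W l)"
      "\<And>l. l \<in> rearrangements d \<Longrightarrow> W l ** diagonal_matrix l ** (W l)\<^sup>T = X"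
    by metis
  then have oW: "\<And>l. l \<in> rearrangements d \<Longrightarrow> orthogonal_matrix (W l)"
    by (simp add: rotation_matrix_def)
  let ?Q = "pad_matrices ` SO_product ks :: (real^'p^'p^'p) set"
  let ?T = "piece_indices d" and ?S = "\<lambda>(l, P). fiber_piece (W l) l P"
  have card_T: "card ?T = 2 ^ (length ks - 1) * (fact CARD('p) div prod_list (map fact ks))"
    using ks by (rule card_piece_indices)
  have "diffeomorphic (\<Union>t\<in>?T. ?S t) (disjoint_copies (card ?T) ?Q)"
  proof (rule diffeomorphic_disjoint_copies)
    show "finite ?T"
      by (simp add: piece_indices_def finite_rearrangements)
    show "disjoint_family_on ?S ?T"
      using oW by (rule disjoint_fiber_pieces)
    fix t assume "t \<in> ?T"
    then obtain l P where t: "t = (l, P)" and l: "l \<in> rearrangements d"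
      by (auto simp: piece_indices_def)
    have orth: "orthogonal_matrix (W l ** block_reflection l P)"
      using oW[OF l] by (intro orthogonal_matrix_mul orthogonal_block_reflection)
    show "closed (?S t)"
      using closed_block_coset[OF orth] by (simp add: t fiber_piece_def)
    have "mset ks = image_mset (\<lambda>c. card (l -` {c})) (mset_set (range l))"
      using l unfolding ks mset_multiplicities range_rearrangement[OF l]
      by (simp add: rearrangements_def)
    then obtain cs e where "block_numbering l cs ks e"
      by (rule ex_block_numbering)
    from block_numbering.diffeomorphic_block_coset[OF this orth]
    show "diffeomorphic (?S t) ?Q"
      by (simp add: t fiber_piece_def)
  qed
  then show ?thesis
    using eigen_fiber_eq_Union_fiber_pieces[OF Ud W] card_T by simp
qed

end
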